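(* Let $q$ be a prime power, $n$ a positive integer, $I,J$ positive integers with $I<J<n/2$, and put $K:=J-I$. Let $\alpha,\beta,\gamma,\overline{\alpha},\overline{\beta},\overline{\gamma}\in\mathbb{F}_{q^n}^*$. The two sets $U_{\alpha,\beta,\gamma}^{I,J,n}$ and $U_{\overline{\alpha},\overline{\beta},\overline{\gamma}}^{I,J,n}$ are $\Gamma L(6,q^n)$-equivalent if and only if there exists $\sigma\in\mathrm{Aut}(\mathbb{F}_{q^n})$ such that at least one of the three elements $$\left(\frac{\overline{\alpha}}{\alpha^{\sigma}}\right)\left(\frac{\overline{\gamma}}{\gamma^{\sigma}}\right)^{q^{K}}\left(\frac{\beta^{\sigma}}{\overline{\beta}}\right)^{q^{2K}},\qquad \left(\frac{\overline{\gamma}}{\alpha^{\sigma}}\right)\left(\frac{1}{\gamma^{\sigma}\overline{\beta}}\right)^{q^{K}}\left(\overline{\alpha}\beta^{\sigma}\right)^{q^{2K}},\qquad \left(\frac{1}{\alpha^{\sigma}\overline{\beta}}\right)\left(\frac{\overline{\alpha}}{\gamma^{\sigma}}\right)^{q^{K}}\left(\overline{\gamma}\beta^{\sigma}\right)^{q^{2K}}$$ is a $(q^{3K}-1)$-th power in $\mathbb{F}_{q^n}$.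
   Context: For positive integers $I<J<n$ and $\alpha,\beta,\gamma\in\mathbb{F}_{q^n}^*$, $$U_{\alpha,\beta,\gamma}^{I,J,n}:=\{(x,y,z,\;x^{q^I}+\alpha y^{q^J},\;x^{q^J}+\beta z^{q^I},\;y^{q^I}+\gamma z^{q^J}) : x,y,z\in\mathbb{F}_{q^n}\}\subseteq\mathbb{F}_{q^n}^6 .$$ Two $\mathbb{F}_q$-subspaces $U,U'$ of $\mathbb{F}_{q^n}^6$ are $\Gamma L(6,q^n)$-equivalent if there exist $M\in GL(6,\mathbb{F}_{q^n})$ and a field automorphism $\sigma\in\mathrm{Aut}(\mathbb{F}_{q^n})$ such that $U'=\{M u^{\sigma} : u\in U\}$, where $\sigma$ acts coordinatewise on column vectors. For $a\in\mathbb{F}_{q^n}$, $a^{\sigma}$ denotes the image of $a$ under $\sigma$. The overlined letters are simply further elements of $\mathbb{F}_{q^n}^*$. An element $c\in\mathbb{F}_{q^n}$ is a $d$-th power in $\mathbb{F}_{q^n}$ if $c=\xi^d$ for some $\xi\in\mathbb{F}_{q^n}$. *)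

theory Defs
  imports
    "HOL-Analysis.Cartesian_Space"
    "HOL-Computational_Algebra.Primes"
    "HOL-Computational_Algebra.Nth_Powers"
    "HOL-Number_Theory.Prime_Powers"
begin

definition field_automorphism :: "('a::field \<Rightarrow> 'a) \<Rightarrow> bool" where
  "field_automorphism \<sigma> \<longleftrightarrow>
     bij \<sigma> \<and> \<sigma> 1 = 1 \<and>
     (\<forall>x y. \<sigma> (x + y) = \<sigma> x + \<sigma> y) \<and> (\<forall>x y. \<sigma> (x * y) = \<sigma> x * \<sigma> y)"

text \<open>
  The orbit relation of the semilinear group \<open>\<Gamma>L(m, F)\<close> on subsets of \<open>F^m\<close>, where \<open>F\<close> is the
  type \<^typ>\<open>'a\<close> and \<open>m\<close> is the cardinality of the index type \<^typ>\<open>'m\<close>. It makes sense for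
  arbitrary subsets; for a subspace over a subfield it is the usual equivalence of subspaces.
\<close>

definition GammaL_equivalent :: "('a::field ^ 'm) set \<Rightarrow> ('a ^ 'm) set \<Rightarrow> bool" where
  "GammaL_equivalent U U' \<longleftrightarrow>
     (\<exists>(M :: 'a ^ 'm ^ 'm) \<sigma>. invertible M \<and> field_automorphism \<sigma> \<and>
        U' = {M *v (\<chi> i. \<sigma> (u $ i)) | u. u \<in> U})"

text \<open>
  The type \<^typ>\<open>'a\<close> plays the role of the field with \<open>q^n\<close> elements, so \<open>n\<close> is not a parameter.
\<close>

definition U_set ::
  "nat \<Rightarrow> nat \<Rightarrow> nat \<Rightarrow> 'a::finite_field \<Rightarrow> 'a \<Rightarrow> 'a \<Rightarrow> ('a ^ 6) set" where
  "U_set q I J \<alpha> \<beta> \<gamma> =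
     {vector [x, y, z,
              x ^ (q ^ I) + \<alpha> * y ^ (q ^ J),
              x ^ (q ^ J) + \<beta> * z ^ (q ^ I),
              y ^ (q ^ I) + \<gamma> * z ^ (q ^ J)] | x y z. True}"

end

(* A linear equivalence M carries one set to the other exactly when, writing M in 3x3 blocks and
   comparing coefficients of q-polynomials of degree < q^n, the upper right block vanishes (look at
   the exponent q^(2J)) and the entries of the upper left block satisfy nine binomial equations.
   These split into three cycles of the shape b^(q^J) = P a^(q^I), c^(q^J) = Q b^(q^I),
   a^(q^J) = R c^(q^I). Eliminating b and c shows that a cycle has a nonzero solution iff
   P Q^(q^K) R^(q^(2K)) is a (q^(3K) - 1)-th power, and one nonzero cycle already gives an
   invertible monomial M. The elements in the theorem are the inverses of these products. *)

theory Submission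
  imports Defs "HOL-Computational_Algebra.Polynomial" "HOL-Number_Theory.Residues"
begin

section \<open>Coordinates of vectors of length six\<close>

lemma exhaust_6:
  fixes x :: 6
  shows "x = 1 \<or> x = 2 \<or> x = 3 \<or> x = 4 \<or> x = 5 \<or> x = 6"
proof (induct x)
  case (of_int z)
  \<comment> \<open>Indices live modulo 6 with representatives 0 to 5; the index \<open>6\<close> is
    the residue 0.\<close>
  then have "z = 0 \<or> z = 1 \<or> z = 2 \<or> z = 3 \<or> z = 4 \<or> z = 5" by fastforce
  then show ?case by auto
qed

lemma forall_6: "(\<forall>i::6. P i) \<longleftrightarrow> P 1 \<and> P 2 \<and> P 3 \<and> P 4 \<and> P 5 \<and> P 6"
  by (metis exhaust_6)

lemma UNIV_6: "UNIV = {1, 2, 3, 4, 5, 6::6}"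
  using exhaust_6 by auto

lemma sum_6: "sum f (UNIV::6 set) = f 1 + f 2 + f 3 + f 4 + f 5 + f 6"
  unfolding UNIV_6 by (simp add: ac_simps)

lemma vector_6 [simp]:
  "(vector [a,b,c,d,e,f] :: ('a::zero)^6) $ 1 = a"
  "(vector [a,b,c,d,e,f] :: ('a::zero)^6) $ 2 = b"
  "(vector [a,b,c,d,e,f] :: ('a::zero)^6) $ 3 = c"
  "(vector [a,b,c,d,e,f] :: ('a::zero)^6) $ 4 = d"
  "(vector [a,b,c,d,e,f] :: ('a::zero)^6) $ 5 = e"
  "(vector [a,b,c,d,e,f] :: ('a::zero)^6) $ 6 = f"
  unfolding vector_def by simp_all

section \<open>Powers, field automorphisms and the characteristic\<close>

text \<open>Eliminating along a cycle produces the inverses of the elements in the theorem; this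
  makes the two forms interchangeable.\<close>

lemma is_nth_power_inverse_iff:
  fixes x :: "'a::field"
  shows "is_nth_power m (inverse x) \<longleftrightarrow> is_nth_power m x"
  unfolding is_nth_power_def by (metis inverse_inverse_eq power_inverse)

lemma field_automorphism_zero: "field_automorphism \<sigma> \<Longrightarrow> \<sigma> 0 = 0"
  unfolding field_automorphism_def by (metis add_cancel_right_right)

lemma field_automorphism_nonzero:
  "field_automorphism \<sigma> \<Longrightarrow> x \<noteq> 0 \<Longrightarrow> \<sigma> x \<noteq> 0"
  using field_automorphism_zero[of \<sigma>] unfolding field_automorphism_def
  by (metis bij_pointE)

lemma field_automorphism_power:
  "field_automorphism \<sigma> \<Longrightarrow> \<sigma> (x ^ k) = \<sigma> x ^ k"
  unfolding field_automorphism_def by (induction k) auto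

text \<open>The characteristic divides the order of the field, which is a power of the prime below
  \<open>q\<close>, so it is that prime.\<close>

lemma CHAR_power_of_card:
  assumes "primepow q" "n > 0" "CARD('a::finite_field) = q ^ n"
  obtains e where "e > 0" "q = CHAR('a) ^ e"
proof -
  obtain p k where p: "prime p" "k > 0" "q = p ^ k"
    using assms(1) by (auto simp: primepow_def)
  have "prime CHAR('a)"
    by (rule prime_CHAR_semidom) (simp add: finite_imp_CHAR_pos)
  moreover have "CHAR('a) dvd p ^ (k * n)"
    using CHAR_dvd_CARD[where 'a='a] assms(3) p by (simp add: power_mult)
  ultimately have "CHAR('a) = p"
    using p(1) by (metis prime_dvd_power primes_dvd_imp_eq)
  with p that show ?thesis by blast
qed

section \<open>Iterates of the q-Frobenius map\<close>

text \<open>Being a positive power of the characteristic makes raising to the power \<open>q\<close>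
  an injective ring homomorphism. The order of the field enters later, as a separate assumption,
  when q-polynomials are compared. The parameter \<open>ty\<close> pins down the field type.\<close>

locale frobenius_field =
  fixes q :: nat and ty :: "'a::finite_field itself"
  assumes q_power: "\<exists>e>0. q = CHAR('a) ^ e"
begin

definition Fr :: "nat \<Rightarrow> 'a \<Rightarrow> 'a" where
  "Fr i x = x ^ (q ^ i)"

lemma prime_CHAR: "prime CHAR('a)"
  by (rule prime_CHAR_semidom) (simp add: finite_imp_CHAR_pos)

lemma q_gt_1: "q > 1"
  using q_power prime_gt_1_nat[OF prime_CHAR] by (metis one_less_power)

lemma Fr_add: "Fr i (x + y) = Fr i x + Fr i y"
proof -
  obtain e where "q = CHAR('a) ^ e" using q_power by blast
  then have "q ^ i = CHAR('a) ^ (e * i)" by (simp add: power_mult)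
  then show ?thesis
    unfolding Fr_def using freshmans_dream'[OF prime_CHAR] by blast
qed

lemma Fr_zero [simp]: "Fr i 0 = 0"
  using q_gt_1 by (simp add: Fr_def)

lemma Fr_mult: "Fr i (x * y) = Fr i x * Fr i y"
  by (simp add: Fr_def power_mult_distrib)

lemma Fr_Fr: "Fr i (Fr j x) = Fr (i + j) x"
  by (simp add: Fr_def power_mult[symmetric] power_add mult.commute)

lemma Fr_eq_0_iff [simp]: "Fr i x = 0 \<longleftrightarrow> x = 0"
  using q_gt_1 by (simp add: Fr_def)

text \<open>An additive map with trivial kernel is injective, and the kernel is trivial because a
  field has no nilpotents.\<close>

lemma inj_Fr: "inj (Fr i)"
proof (rule injI)
  fix x y assume "Fr i x = Fr i y"
  moreover have "Fr i x = Fr i (x - y) + Fr i y"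
    by (simp flip: Fr_add)
  ultimately show "x = y" by simp
qed

lemma Fr_surj: obtains y where "Fr i y = x"
  using finite_UNIV_inj_surj[OF finite inj_Fr] by (metis surjD)

section \<open>Cycles of three binomial equations\<close>

text \<open>Since J = I + K, applying \<open>Fr K\<close> to the second equation and
  \<open>Fr (2 * K)\<close> to the third lets \<open>b\<close> and \<open>c\<close> be eliminated.
  With s = \<open>Fr I a\<close> what remains is \<open>Fr (3 * K)\<close> s = E * s, that is, E =
  s^(q^(3K) - 1) for nonzero s.\<close>

lemma cycle_solvable_iff:
  assumes "P \<noteq> 0" "Q \<noteq> 0" "R \<noteq> 0" and J: "J = I + K" and "0 < K"
  shows "(\<exists>a b c. a \<noteq> 0 \<and> b \<noteq> 0 \<and> c \<noteq> 0 \<and>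
            Fr J b = P * Fr I a \<and> Fr J c = Q * Fr I b \<and> Fr J a = R * Fr I c)
     \<longleftrightarrow> is_nth_power (q ^ (3 * K) - 1) (P * Fr K Q * Fr (2 * K) R)"
    (is "?L \<longleftrightarrow> is_nth_power ?m ?E")
proof -
  \<comment> \<open>Multiplying by \<open>x\<close> instead of dividing keeps the identity valid at
    0.\<close>
  have pow: "x ^ ?m * x = Fr (3 * K) x" for x
  proof -
    have "x ^ ?m * x = x ^ Suc ?m" by (simp add: mult.commute)
    also have "Suc ?m = q ^ (3 * K)" using q_gt_1 by simp
    finally show ?thesis by (simp add: Fr_def)
  qed
  have elim: "Fr (2 * K) (R * Fr I c) = ?E * Fr I a"
    if "Fr J b = P * Fr I a" "Fr J c = Q * Fr I b" for a b c
  proof -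
    have "Fr (2 * K) (R * Fr I c) = Fr (2 * K) R * Fr K (Fr J c)"
      by (simp add: Fr_mult Fr_Fr J algebra_simps mult_2_right)
    also have "Fr K (Fr J c) = Fr K Q * Fr J b"
      unfolding that(2) by (simp add: Fr_mult Fr_Fr J algebra_simps)
    finally show ?thesis using that(1) by (simp add: mult_ac)
  qed
  have shift: "Fr (2 * K) (Fr J a) = Fr (3 * K) (Fr I a)" for a
    by (simp add: Fr_Fr J algebra_simps)
  show ?thesis
  proof
    assume ?L
    then obtain a b c where abc: "a \<noteq> 0" "Fr J b = P * Fr I a" "Fr J c = Q * Fr I b"
      "Fr J a = R * Fr I c" by blast
    have "(Fr I a) ^ ?m * Fr I a = ?E * Fr I a"
      using elim[OF abc(2,3)] shift[of a] abc(4) pow[of "Fr I a"] by simp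
    then show "is_nth_power ?m ?E"
      using abc(1) by (metis Fr_eq_0_iff is_nth_powerI mult_right_cancel)
  next
    assume "is_nth_power ?m ?E"
    then obtain \<xi> where \<xi>: "?E = \<xi> ^ ?m" by (auto elim: is_nth_powerE)
    obtain a where a: "Fr I a = \<xi>" by (rule Fr_surj)
    \<comment> \<open>A positive exponent is essential here: a zeroth power would be 1 even for
      \<xi> = 0, whereas a zero \<xi> now contradicts the nonzero product.\<close>
    have "?m > 0" using one_less_power[OF q_gt_1, of "3 * K"] \<open>0 < K\<close> by simp
    moreover have "?E \<noteq> 0" using assms(1-3) by simp
    ultimately have "\<xi> \<noteq> 0" unfolding \<xi> by (auto simp: power_0_left)
    with a have a0: "a \<noteq> 0" by auto
    have aE: "?E * Fr I a = Fr (3 * K) (Fr I a)"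
      unfolding a \<xi> by (rule pow)
    obtain b where b: "Fr J b = P * Fr I a" by (rule Fr_surj)
    obtain c where c: "Fr J c = Q * Fr I b" by (rule Fr_surj)
    have "Fr J b \<noteq> 0" unfolding b using a0 assms(1) by simp
    then have b0: "b \<noteq> 0" by auto
    have "Fr J c \<noteq> 0" unfolding c using b0 assms(2) by simp
    then have c0: "c \<noteq> 0" by auto
    \<comment> \<open>\<open>b\<close> and \<open>c\<close> were chosen to solve the first two
      equations; the third is checked after applying \<open>Fr (2 * K)\<close>, which injectivity
      then cancels.\<close>
    have "Fr (2 * K) (Fr J a) = Fr (2 * K) (R * Fr I c)"
      unfolding elim[OF b c] aE by (rule shift)
    then have "Fr J a = R * Fr I c" by (rule injD[OF inj_Fr])
    with a0 b0 c0 b c show ?L by blast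
  qed
qed

section \<open>Coefficients of q-polynomials\<close>

text \<open>Such a q-polynomial has ordinary degree at most q^(n-1), less than the number q^n of
  field elements, so vanishing everywhere forces it to be the zero polynomial.\<close>

lemma q_polynomial_eq_0:
  fixes c :: "nat \<Rightarrow> 'a"
  assumes card: "CARD('a) = q ^ n"
    and zero: "\<And>t. (\<Sum>i<n. c i * Fr i t) = 0" and "i < n"
  shows "c i = 0"
proof -
  define p where "p = (\<Sum>i<n. Polynomial.monom (c i) (q ^ i))"
  have n: "n > 0" using \<open>i < n\<close> by simp
  have "degree p \<le> q ^ (n - 1)" unfolding p_def
  proof (rule degree_sum_le)
    fix j assume "j \<in> {..<n}"
    then have "q ^ j \<le> q ^ (n - 1)" using q_gt_1 by (intro power_increasing) auto
    then show "degree (Polynomial.monom (c j) (q ^ j)) \<le> q ^ (n - 1)"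
      using degree_monom_le order_trans by blast
  qed simp
  also have "\<dots> < CARD('a)" unfolding card using q_gt_1 n by (intro power_strict_increasing) auto
  finally have deg: "degree p < CARD('a)" .
  have "poly p t = 0" for t
    using zero[of t] by (simp add: p_def poly_sum poly_monom Fr_def)
  then have "p = 0"
    using deg by (intro poly_eqI_degree[of UNIV]) auto
  \<comment> \<open>As q > 1, the exponents q^j are distinct and only the i-th monomial
    contributes.\<close>
  then have "0 = Polynomial.coeff p (q ^ i)" by simp
  also have "\<dots> = (\<Sum>j<n. if j = i then c j else 0)"
    unfolding p_def coeff_sum
    using q_gt_1 by (intro sum.cong) (auto simp: coeff_monom power_inject_exp)
  also have "\<dots> = c i" using \<open>i < n\<close> by simp
  finally show ?thesis by simp
qed

lemma sum_if_Fr: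
  assumes "k < n"
  shows "(\<Sum>i<n. (if i = k then s else 0) * Fr i t) = s * Fr k t"
proof -
  have "(\<Sum>i<n. (if i = k then s else 0) * Fr i t) = (\<Sum>i<n. if i = k then s * Fr i t else 0)"
    by (intro sum.cong) auto
  also have "\<dots> = s * Fr k t" using assms by simp
  finally show ?thesis .
qed

text \<open>A common template for nine identities: one for each of the last three coordinates of the
  image and each of the variables x, y, z. In the template, \<open>b\<close>, \<open>b'\<close>,
  \<open>e\<close> and \<open>e'\<close> stand for entries of the upper right block of the matrix,
  up to nonzero factors.\<close>

lemma compare_coefficients:
  assumes card: "CARD('a) = q ^ n" and IJ: "0 < I" "I < J" "2 * J < n"
    and "\<delta> \<noteq> 0"
    and eq: "\<And>t. \<epsilon> * Fr I (a * t + b * Fr I t + b' * Fr J t)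
            + \<delta> * Fr J (a' * t + e * Fr I t + e' * Fr J t) = c * t + d * Fr I t + d' * Fr J t"
  shows "e' = 0"
    and "b = 0 \<Longrightarrow> b' = 0 \<Longrightarrow> e = 0 \<Longrightarrow> \<epsilon> * Fr I a = d \<and> \<delta> * Fr J a' = d'"
proof -
  \<comment> \<open>The conditionals are added rather than nested because the exponents 2I and J may
    coincide.\<close>
  define C where "C i = (if i = I then \<epsilon> * Fr I a - d else 0)
     + (if i = 2 * I then \<epsilon> * Fr I b else 0) + (if i = I + J then \<epsilon> * Fr I b' + \<delta> * Fr J e else 0)
     + (if i = J then \<delta> * Fr J a' - d' else 0) + (if i = 2 * J then \<delta> * Fr J e' else 0)
     + (if i = 0 then - c else 0)" for i
  have "(\<Sum>i<n. C i * Fr i t) = 0" for t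
  proof -
    have "(\<Sum>i<n. C i * Fr i t) = (\<epsilon> * Fr I a - d) * Fr I t + \<epsilon> * Fr I b * Fr (2 * I) t
        + (\<epsilon> * Fr I b' + \<delta> * Fr J e) * Fr (I + J) t + (\<delta> * Fr J a' - d') * Fr J t
        + \<delta> * Fr J e' * Fr (2 * J) t + (- c) * Fr 0 t"
      unfolding C_def distrib_right[of _ _ "Fr _ t"] sum.distrib
      using IJ by (subst (1 2 3 4 5 6) sum_if_Fr) (auto simp: algebra_simps)
    also have "\<dots> = 0"
      using eq[of t] by (simp add: Fr_add Fr_mult Fr_Fr algebra_simps mult_2_right) (simp add: Fr_def)
    finally show ?thesis .
  qed
  note C0 = q_polynomial_eq_0[OF card this]
  \<comment> \<open>The exponent 2J is the largest and meets no other; being below n, it can be read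
    off.\<close>
  have "C (2 * J) = \<delta> * Fr J e'" using IJ by (simp add: C_def)
  then show e': "e' = 0" using C0[of "2 * J"] IJ \<open>\<delta> \<noteq> 0\<close> by simp
  assume z: "b = 0" "b' = 0" "e = 0"
  \<comment> \<open>Once \<open>b\<close> is zero, a coincidence 2I = J no longer disturbs the
    coefficient at J.\<close>
  have "C I = \<epsilon> * Fr I a - d" "C J = \<delta> * Fr J a' - d'" using IJ z by (auto simp: C_def)
  then show "\<epsilon> * Fr I a = d \<and> \<delta> * Fr J a' = d'"
    using C0[of I] C0[of J] IJ by simp
qed

section \<open>Linear maps between the sets U\<close>

lemma mem_U_set_iff:
  "v \<in> U_set q I J \<alpha> \<beta> \<gamma> \<longleftrightarrow>
     v $ 4 = Fr I (v $ 1) + \<alpha> * Fr J (v $ 2) \<and>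
     v $ 5 = Fr J (v $ 1) + \<beta> * Fr I (v $ 3) \<and>
     v $ 6 = Fr I (v $ 2) + \<gamma> * Fr J (v $ 3)"
  unfolding U_set_def Fr_def by (auto simp: vec_eq_iff forall_6)

text \<open>The first three coordinates parametrise the set, so its size does not depend on the
  parameters. This later upgrades an inclusion to an equality.\<close>

lemma card_U_set:
  fixes \<alpha> \<beta> \<gamma> :: 'a
  shows "card (U_set q I J \<alpha> \<beta> \<gamma>) = CARD('a \<times> 'a \<times> 'a)"
proof -
  let ?g = "\<lambda>(x :: 'a, y :: 'a, z :: 'a). vector [x, y, z, Fr I x + \<alpha> * Fr J y, Fr J x + \<beta> * Fr I z,
              Fr I y + \<gamma> * Fr J z] :: 'a ^ 6"
  have "U_set q I J \<alpha> \<beta> \<gamma> = range ?g"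
  proof (intro subset_antisym subsetI)
    fix v assume "v \<in> U_set q I J \<alpha> \<beta> \<gamma>"
    then have "v = ?g (v $ 1, v $ 2, v $ 3)"
      by (simp add: mem_U_set_iff vec_eq_iff forall_6)
    then show "v \<in> range ?g" by (rule range_eqI)
  qed (auto simp: mem_U_set_iff)
  moreover have "inj ?g"
    by (rule injI) (auto simp: vec_eq_iff forall_6)
  ultimately show ?thesis by (simp only: card_image)
qed

text \<open>A trivial kernel makes M invertible; the image then has the size of the target set, so
  inclusion suffices.\<close>

lemma matrix_image_U_setI:
  fixes M :: "'a ^ 6 ^ 6"
  assumes ker: "\<And>v. M *v v = 0 \<Longrightarrow> v = 0"
    and sub: "\<And>v. v \<in> U_set q I J \<alpha> \<beta> \<gamma> \<Longrightarrow> M *v v \<in> U_set q I J \<alpha>' \<beta>' \<gamma>'"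
  shows "invertible M \<and> U_set q I J \<alpha>' \<beta>' \<gamma>' = (*v) M ` U_set q I J \<alpha> \<beta> \<gamma>"
proof
  have "\<exists>B. B ** M = mat 1"
    using ker matrix_left_invertible_ker by blast
  then show "invertible M"
    by (simp add: invertible_left_inverse)
  have "inj ((*v) M)"
    using \<open>\<exists>B. B ** M = mat 1\<close> matrix_left_invertible_injective by blast
  then have "card ((*v) M ` U_set q I J \<alpha> \<beta> \<gamma>) = card (U_set q I J \<alpha>' \<beta>' \<gamma>')"
    by (subst card_image) (auto simp: card_U_set intro: inj_on_subset)
  then show "U_set q I J \<alpha>' \<beta>' \<gamma>' = (*v) M ` U_set q I J \<alpha> \<beta> \<gamma>"
    using sub by (intro card_subset_eq[symmetric]) auto
qed

text \<open>Each entry of the lower right block is determined in two ways by the upper left block;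
  equating the two gives the nine binomial equations.\<close>

lemma invertible_image_U_set_imp:
  fixes M :: "'a ^ 6 ^ 6"
  assumes card: "CARD('a) = q ^ n" and IJ: "0 < I" "I < J" "2 * J < n"
    and nz: "\<alpha> \<noteq> 0" "\<beta> \<noteq> 0" "\<gamma> \<noteq> 0" "\<alpha>' \<noteq> 0" "\<beta>' \<noteq> 0" "\<gamma>' \<noteq> 0"
    and M: "invertible M" "U_set q I J \<alpha>' \<beta>' \<gamma>' = (*v) M ` U_set q I J \<alpha> \<beta> \<gamma>"
  shows "M $ 1 $ 1 \<noteq> 0 \<or> M $ 1 $ 2 \<noteq> 0 \<or> M $ 1 $ 3 \<noteq> 0"
    and "\<alpha>' * Fr J (M $ 2 $ 2) = \<alpha> * Fr I (M $ 1 $ 1)"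
    and "Fr I (M $ 1 $ 3) = \<beta> * \<alpha>' * Fr J (M $ 2 $ 1)"
    and "\<alpha>' * Fr J (M $ 2 $ 3) = \<gamma> * Fr I (M $ 1 $ 2)"
    and "Fr J (M $ 1 $ 2) = \<alpha> * \<beta>' * Fr I (M $ 3 $ 1)"
    and "Fr J (M $ 1 $ 3) = \<gamma> * \<beta>' * Fr I (M $ 3 $ 2)"
    and "\<beta>' * Fr I (M $ 3 $ 3) = \<beta> * Fr J (M $ 1 $ 1)"
    and "\<gamma>' * Fr J (M $ 3 $ 2) = \<alpha> * Fr I (M $ 2 $ 1)"
    and "\<gamma>' * Fr J (M $ 3 $ 3) = \<gamma> * Fr I (M $ 2 $ 2)"
    and "Fr I (M $ 2 $ 3) = \<beta> * \<gamma>' * Fr J (M $ 3 $ 1)"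
proof -
  define m where "m i j = M $ i $ j" for i j
  have mem: "M *v vector [x, y, z, Fr I x + \<alpha> * Fr J y, Fr J x + \<beta> * Fr I z,
      Fr I y + \<gamma> * Fr J z] \<in> U_set q I J \<alpha>' \<beta>' \<gamma>'" for x y z
    unfolding M(2) by (rule imageI) (simp add: mem_U_set_iff)
  note mem = mem[unfolded mem_U_set_iff matrix_vector_mult_def, simplified sum_6, simplified,
      folded m_def]
  note cmp = compare_coefficients[OF card IJ]
  \<comment> \<open>Two of the three variables are set to zero. The factors 1 and the order of the
    summands fit each identity to the template, whose second summand carries
    \<open>Fr J\<close>.\<close>
  have x: "1 * Fr I (m 1 1 * t + m 1 4 * Fr I t + m 1 5 * Fr J t)
      + \<alpha>' * Fr J (m 2 1 * t + m 2 4 * Fr I t + m 2 5 * Fr J t)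
      = m 4 1 * t + m 4 4 * Fr I t + m 4 5 * Fr J t"
    "\<beta>' * Fr I (m 3 1 * t + m 3 4 * Fr I t + m 3 5 * Fr J t)
      + 1 * Fr J (m 1 1 * t + m 1 4 * Fr I t + m 1 5 * Fr J t)
      = m 5 1 * t + m 5 4 * Fr I t + m 5 5 * Fr J t"
    "1 * Fr I (m 2 1 * t + m 2 4 * Fr I t + m 2 5 * Fr J t)
      + \<gamma>' * Fr J (m 3 1 * t + m 3 4 * Fr I t + m 3 5 * Fr J t)
      = m 6 1 * t + m 6 4 * Fr I t + m 6 5 * Fr J t" for t
    using mem[of t 0 0] by (simp_all add: algebra_simps)
  have y: "1 * Fr I (m 1 2 * t + m 1 6 * Fr I t + (m 1 4 * \<alpha>) * Fr J t)
      + \<alpha>' * Fr J (m 2 2 * t + m 2 6 * Fr I t + (m 2 4 * \<alpha>) * Fr J t)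
      = m 4 2 * t + m 4 6 * Fr I t + (m 4 4 * \<alpha>) * Fr J t"
    "\<beta>' * Fr I (m 3 2 * t + m 3 6 * Fr I t + (m 3 4 * \<alpha>) * Fr J t)
      + 1 * Fr J (m 1 2 * t + m 1 6 * Fr I t + (m 1 4 * \<alpha>) * Fr J t)
      = m 5 2 * t + m 5 6 * Fr I t + (m 5 4 * \<alpha>) * Fr J t"
    "1 * Fr I (m 2 2 * t + m 2 6 * Fr I t + (m 2 4 * \<alpha>) * Fr J t)
      + \<gamma>' * Fr J (m 3 2 * t + m 3 6 * Fr I t + (m 3 4 * \<alpha>) * Fr J t)
      = m 6 2 * t + m 6 6 * Fr I t + (m 6 4 * \<alpha>) * Fr J t" for t
    using mem[of 0 t 0] by (simp_all add: algebra_simps)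
  have z: "1 * Fr I (m 1 3 * t + (m 1 5 * \<beta>) * Fr I t + (m 1 6 * \<gamma>) * Fr J t)
      + \<alpha>' * Fr J (m 2 3 * t + (m 2 5 * \<beta>) * Fr I t + (m 2 6 * \<gamma>) * Fr J t)
      = m 4 3 * t + (m 4 5 * \<beta>) * Fr I t + (m 4 6 * \<gamma>) * Fr J t"
    "\<beta>' * Fr I (m 3 3 * t + (m 3 5 * \<beta>) * Fr I t + (m 3 6 * \<gamma>) * Fr J t)
      + 1 * Fr J (m 1 3 * t + (m 1 5 * \<beta>) * Fr I t + (m 1 6 * \<gamma>) * Fr J t)
      = m 5 3 * t + (m 5 5 * \<beta>) * Fr I t + (m 5 6 * \<gamma>) * Fr J t"
    "1 * Fr I (m 2 3 * t + (m 2 5 * \<beta>) * Fr I t + (m 2 6 * \<gamma>) * Fr J t)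
      + \<gamma>' * Fr J (m 3 3 * t + (m 3 5 * \<beta>) * Fr I t + (m 3 6 * \<gamma>) * Fr J t)
      = m 6 3 * t + (m 6 5 * \<beta>) * Fr I t + (m 6 6 * \<gamma>) * Fr J t" for t
    using mem[of 0 0 t] by (simp_all add: algebra_simps)
  \<comment> \<open>Each of the nine identities kills one entry of the upper right block, through
    its coefficient at 2J.\<close>
  have B: "m 2 5 = 0" "m 1 5 = 0" "m 3 5 = 0" "m 2 4 = 0" "m 1 4 = 0" "m 3 4 = 0"
    "m 2 6 = 0" "m 1 6 = 0" "m 3 6 = 0"
    using cmp(1)[OF nz(4) x(1)] cmp(1)[OF one_neq_zero x(2)] cmp(1)[OF nz(6) x(3)]
      cmp(1)[OF nz(4) y(1)] cmp(1)[OF one_neq_zero y(2)] cmp(1)[OF nz(6) y(3)]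
      cmp(1)[OF nz(4) z(1)] cmp(1)[OF one_neq_zero z(2)] cmp(1)[OF nz(6) z(3)] nz by auto
  have X: "Fr I (m 1 1) = m 4 4 \<and> \<alpha>' * Fr J (m 2 1) = m 4 5"
    "\<beta>' * Fr I (m 3 1) = m 5 4 \<and> Fr J (m 1 1) = m 5 5"
    "Fr I (m 2 1) = m 6 4 \<and> \<gamma>' * Fr J (m 3 1) = m 6 5"
    using cmp(2)[OF nz(4) x(1)] cmp(2)[OF one_neq_zero x(2)] cmp(2)[OF nz(6) x(3)] B by simp_all
  have Y: "Fr I (m 1 2) = m 4 6 \<and> \<alpha>' * Fr J (m 2 2) = m 4 4 * \<alpha>"
    "\<beta>' * Fr I (m 3 2) = m 5 6 \<and> Fr J (m 1 2) = m 5 4 * \<alpha>"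
    "Fr I (m 2 2) = m 6 6 \<and> \<gamma>' * Fr J (m 3 2) = m 6 4 * \<alpha>"
    using cmp(2)[OF nz(4) y(1)] cmp(2)[OF one_neq_zero y(2)] cmp(2)[OF nz(6) y(3)] B by simp_all
  have Z: "Fr I (m 1 3) = m 4 5 * \<beta> \<and> \<alpha>' * Fr J (m 2 3) = m 4 6 * \<gamma>"
    "\<beta>' * Fr I (m 3 3) = m 5 5 * \<beta> \<and> Fr J (m 1 3) = m 5 6 * \<gamma>"
    "Fr I (m 2 3) = m 6 5 * \<beta> \<and> \<gamma>' * Fr J (m 3 3) = m 6 6 * \<gamma>"
    using cmp(2)[OF nz(4) z(1)] cmp(2)[OF one_neq_zero z(2)] cmp(2)[OF nz(6) z(3)] B by simp_all
  show "M $ 1 $ 1 \<noteq> 0 \<or> M $ 1 $ 2 \<noteq> 0 \<or> M $ 1 $ 3 \<noteq> 0"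
  proof (rule ccontr)
    assume "\<not> ?thesis"
    then have "M $ 1 = 0"
      \<comment> \<open>With the upper right block zero, a vanishing left half would make the whole
        first row zero.\<close>
      using B by (simp add: vec_eq_iff forall_6 m_def)
    then have "(M ** N) $ 1 $ 1 = 0" for N :: "'a ^ 6 ^ 6"
      by (simp add: matrix_matrix_mult_def)
    moreover obtain N where "M ** N = mat 1"
      using M(1) by (auto simp: invertible_def)
    moreover have "(mat 1 :: 'a ^ 6 ^ 6) $ 1 $ 1 = 1" by (simp add: mat_def)
    ultimately show False by (metis one_neq_zero)
  qed
  show "\<alpha>' * Fr J (M $ 2 $ 2) = \<alpha> * Fr I (M $ 1 $ 1)"
    "Fr I (M $ 1 $ 3) = \<beta> * \<alpha>' * Fr J (M $ 2 $ 1)"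
    "\<alpha>' * Fr J (M $ 2 $ 3) = \<gamma> * Fr I (M $ 1 $ 2)"
    "Fr J (M $ 1 $ 2) = \<alpha> * \<beta>' * Fr I (M $ 3 $ 1)"
    "Fr J (M $ 1 $ 3) = \<gamma> * \<beta>' * Fr I (M $ 3 $ 2)"
    "\<beta>' * Fr I (M $ 3 $ 3) = \<beta> * Fr J (M $ 1 $ 1)"
    "\<gamma>' * Fr J (M $ 3 $ 2) = \<alpha> * Fr I (M $ 2 $ 1)"
    "\<gamma>' * Fr J (M $ 3 $ 3) = \<gamma> * Fr I (M $ 2 $ 2)"
    "Fr I (M $ 2 $ 3) = \<beta> * \<gamma>' * Fr J (M $ 3 $ 1)"
    unfolding m_def[symmetric] using X Y Z by (auto simp: mult_ac)
qed

section \<open>The criterion for linear equivalence\<close>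

text \<open>The three alternatives belong to the diagonal and the two cyclic permutation patterns of
  the upper left block: \<open>?d\<close> to positions 11, 22, 33, \<open>?c1\<close> to 13, 21, 32
  and \<open>?c2\<close> to 12, 23, 31.\<close>

lemma exists_invertible_image_U_set_iff:
  assumes card: "CARD('a) = q ^ n" and IJ: "0 < I" "J = I + K" "0 < K" "2 * J < n"
    and nz: "\<alpha> \<noteq> 0" "\<beta> \<noteq> 0" "\<gamma> \<noteq> 0" "\<alpha>' \<noteq> 0" "\<beta>' \<noteq> 0" "\<gamma>' \<noteq> 0"
  shows "(\<exists>M. invertible M \<and> U_set q I J \<alpha>' \<beta>' \<gamma>' = (*v) M ` U_set q I J \<alpha> \<beta> \<gamma>) \<longleftrightarrow>
    is_nth_power (q ^ (3 * K) - 1) ((\<alpha> / \<alpha>') * Fr K (\<gamma> / \<gamma>') * Fr (2 * K) (\<beta>' / \<beta>)) \<or>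
    is_nth_power (q ^ (3 * K) - 1) ((\<alpha> / \<gamma>') * Fr K (\<gamma> * \<beta>') * Fr (2 * K) (1 / (\<alpha>' * \<beta>))) \<or>
    is_nth_power (q ^ (3 * K) - 1) ((\<alpha> * \<beta>') * Fr K (\<gamma> / \<alpha>') * Fr (2 * K) (1 / (\<gamma>' * \<beta>)))"
    (is "?equiv \<longleftrightarrow> ?d \<or> ?c1 \<or> ?c2")
proof
  note cyc = cycle_solvable_iff[OF _ _ _ IJ(2,3), symmetric]
  have Fr0: "a \<noteq> 0" if "Fr i a = p * Fr j b" "p \<noteq> 0" "b \<noteq> 0" for a b p i j
    using that by (metis Fr_eq_0_iff mult_eq_0_iff)
  {
    assume ?equiv
    then obtain M :: "'a ^ 6 ^ 6" where M: "invertible M"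
      "U_set q I J \<alpha>' \<beta>' \<gamma>' = (*v) M ` U_set q I J \<alpha> \<beta> \<gamma>" by blast
    have "I < J" using IJ by simp
    note E = invertible_image_U_set_imp[OF card IJ(1) this IJ(4) nz M]
    \<comment> \<open>The column of a nonzero entry in the first row selects the cycle, and the
      equations carry nonvanishing around it.\<close>
    from E(1) show "?d \<or> ?c1 \<or> ?c2"
    proof (elim disjE)
      assume a: "M $ 1 $ 1 \<noteq> 0"
      have e: "Fr J (M $ 2 $ 2) = (\<alpha> / \<alpha>') * Fr I (M $ 1 $ 1)"
        "Fr J (M $ 3 $ 3) = (\<gamma> / \<gamma>') * Fr I (M $ 2 $ 2)"
        "Fr J (M $ 1 $ 1) = (\<beta>' / \<beta>) * Fr I (M $ 3 $ 3)"
        using E(2,7,9) nz by (simp_all add: field_simps)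
      have b: "M $ 2 $ 2 \<noteq> 0" using Fr0[OF e(1)] a nz by simp
      have c: "M $ 3 $ 3 \<noteq> 0" using Fr0[OF e(2)] b nz by simp
      have ?d
        by (subst cyc) (use a b c e nz in \<open>simp_all, blast\<close>)
      then show ?thesis by simp
    next
      assume a: "M $ 1 $ 2 \<noteq> 0"
      have e: "Fr J (M $ 1 $ 2) = (\<alpha> * \<beta>') * Fr I (M $ 3 $ 1)"
        "Fr J (M $ 2 $ 3) = (\<gamma> / \<alpha>') * Fr I (M $ 1 $ 2)"
        "Fr J (M $ 3 $ 1) = (1 / (\<gamma>' * \<beta>)) * Fr I (M $ 2 $ 3)"
        using E(4,5,10) nz by (simp_all add: field_simps)
      have b: "M $ 2 $ 3 \<noteq> 0" using Fr0[OF e(2)] a nz by simp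
      have c: "M $ 3 $ 1 \<noteq> 0" using Fr0[OF e(3)] b nz by simp
      have ?c2
        by (subst cyc) (use a b c e nz in \<open>simp_all, blast\<close>)
      then show ?thesis by simp
    next
      assume a: "M $ 1 $ 3 \<noteq> 0"
      have e: "Fr J (M $ 3 $ 2) = (\<alpha> / \<gamma>') * Fr I (M $ 2 $ 1)"
        "Fr J (M $ 1 $ 3) = (\<gamma> * \<beta>') * Fr I (M $ 3 $ 2)"
        "Fr J (M $ 2 $ 1) = (1 / (\<alpha>' * \<beta>)) * Fr I (M $ 1 $ 3)"
        using E(3,6,8) nz by (simp_all add: field_simps)
      have b: "M $ 2 $ 1 \<noteq> 0" using Fr0[OF e(3)] a nz by simp
      have c: "M $ 3 $ 2 \<noteq> 0" using Fr0[OF e(1)] b nz by simp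
      have ?c1
        by (subst cyc) (use a b c e nz in \<open>simp_all, blast\<close>)
      then show ?thesis by simp
    qed
  }
  assume "?d \<or> ?c1 \<or> ?c2"
  then show ?equiv
  proof (elim disjE)
    assume ?d
    then obtain a b c where n0: "a \<noteq> 0" "b \<noteq> 0" "c \<noteq> 0" and e:
      "Fr J b = (\<alpha> / \<alpha>') * Fr I a" "Fr J c = (\<gamma> / \<gamma>') * Fr I b" "Fr J a = (\<beta>' / \<beta>) * Fr I c"
      using nz by (subst (asm) cyc) auto
    \<comment> \<open>The solution of the cycle fills the upper left block; the entries of the lower
      right block are those forced by comparing coefficients.\<close>
    let ?M = "vector [vector [a,0,0,0,0,0], vector [0,b,0,0,0,0], vector [0,0,c,0,0,0],
      vector [0,0,0,Fr I a,0,0], vector [0,0,0,0,Fr J a,0], vector [0,0,0,0,0,Fr I b]] :: 'a ^ 6 ^ 6"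
    have "invertible ?M \<and> U_set q I J \<alpha>' \<beta>' \<gamma>' = (*v) ?M ` U_set q I J \<alpha> \<beta> \<gamma>"
    proof (rule matrix_image_U_setI)
      show "v = 0" if "?M *v v = 0" for v
        using that n0 by (simp add: vec_eq_iff forall_6 matrix_vector_mult_def sum_6)
      show "?M *v v \<in> U_set q I J \<alpha>' \<beta>' \<gamma>'" if "v \<in> U_set q I J \<alpha> \<beta> \<gamma>" for v
        using that nz by (simp add: mem_U_set_iff matrix_vector_mult_def sum_6 Fr_mult e field_simps)
    qed
    then show ?thesis by blast
  next
    assume ?c1
    then obtain a b c where n0: "a \<noteq> 0" "b \<noteq> 0" "c \<noteq> 0" and e:
      "Fr J b = (\<alpha> / \<gamma>') * Fr I a" "Fr J c = (\<gamma> * \<beta>') * Fr I b" "Fr J a = (1 / (\<alpha>' * \<beta>)) * Fr I c"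
      using nz by (subst (asm) cyc) auto
    \<comment> \<open>Here \<open>a\<close>, \<open>b\<close>, \<open>c\<close> stand at positions
      21, 32, 13, matching the cycle of \<open>?c1\<close>.\<close>
    let ?M = "vector [vector [0,0,c,0,0,0], vector [a,0,0,0,0,0], vector [0,b,0,0,0,0],
      vector [0,0,0,0,\<alpha>' * Fr J a,0], vector [0,0,0,0,0,\<beta>' * Fr I b],
      vector [0,0,0,Fr I a,0,0]] :: 'a ^ 6 ^ 6"
    have "invertible ?M \<and> U_set q I J \<alpha>' \<beta>' \<gamma>' = (*v) ?M ` U_set q I J \<alpha> \<beta> \<gamma>"
    proof (rule matrix_image_U_setI)
      show "v = 0" if "?M *v v = 0" for v
        using that n0 nz by (simp add: vec_eq_iff forall_6 matrix_vector_mult_def sum_6)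
      show "?M *v v \<in> U_set q I J \<alpha>' \<beta>' \<gamma>'" if "v \<in> U_set q I J \<alpha> \<beta> \<gamma>" for v
        using that nz by (simp add: mem_U_set_iff matrix_vector_mult_def sum_6 Fr_mult e field_simps)
    qed
    then show ?thesis by blast
  next
    assume ?c2
    then obtain a b c where n0: "a \<noteq> 0" "b \<noteq> 0" "c \<noteq> 0" and e:
      "Fr J b = (\<alpha> * \<beta>') * Fr I a" "Fr J c = (\<gamma> / \<alpha>') * Fr I b" "Fr J a = (1 / (\<gamma>' * \<beta>)) * Fr I c"
      using nz by (subst (asm) cyc) auto
    \<comment> \<open>Here \<open>a\<close>, \<open>b\<close>, \<open>c\<close> stand at positions
      31, 12, 23, matching the cycle of \<open>?c2\<close>.\<close>
    let ?M = "vector [vector [0,b,0,0,0,0], vector [0,0,c,0,0,0], vector [a,0,0,0,0,0],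
      vector [0,0,0,0,0,Fr I b], vector [0,0,0,\<beta>' * Fr I a,0,0],
      vector [0,0,0,0,\<gamma>' * Fr J a,0]] :: 'a ^ 6 ^ 6"
    have "invertible ?M \<and> U_set q I J \<alpha>' \<beta>' \<gamma>' = (*v) ?M ` U_set q I J \<alpha> \<beta> \<gamma>"
    proof (rule matrix_image_U_setI)
      show "v = 0" if "?M *v v = 0" for v
        using that n0 nz by (simp add: vec_eq_iff forall_6 matrix_vector_mult_def sum_6)
      show "?M *v v \<in> U_set q I J \<alpha>' \<beta>' \<gamma>'" if "v \<in> U_set q I J \<alpha> \<beta> \<gamma>" for v
        using that nz by (simp add: mem_U_set_iff matrix_vector_mult_def sum_6 Fr_mult e field_simps)
    qed
    then show ?thesis by blast
  qed
qed

end

section \<open>From linear to semilinear equivalence\<close>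

text \<open>An automorphism commutes with powers, so it only moves the parameters; its surjectivity
  supplies the reverse inclusion.\<close>

lemma field_automorphism_image_U_set:
  assumes "field_automorphism \<sigma>"
  shows "(\<lambda>u. \<chi> i. \<sigma> (u $ i)) ` U_set q I J \<alpha> \<beta> \<gamma> = U_set q I J (\<sigma> \<alpha>) (\<sigma> \<beta>) (\<sigma> \<gamma>)"
proof -
  have "surj \<sigma>" and hom: "\<And>x y. \<sigma> (x + y) = \<sigma> x + \<sigma> y" "\<And>x y. \<sigma> (x * y) = \<sigma> x * \<sigma> y"
    using assms by (auto simp: field_automorphism_def bij_def)
  have v: "(\<chi> i. \<sigma> (vector [x, y, z, x ^ q ^ I + \<alpha> * y ^ q ^ J, x ^ q ^ J + \<beta> * z ^ q ^ I,
        y ^ q ^ I + \<gamma> * z ^ q ^ J] $ i))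
      = (vector [\<sigma> x, \<sigma> y, \<sigma> z, \<sigma> x ^ q ^ I + \<sigma> \<alpha> * \<sigma> y ^ q ^ J,
        \<sigma> x ^ q ^ J + \<sigma> \<beta> * \<sigma> z ^ q ^ I, \<sigma> y ^ q ^ I + \<sigma> \<gamma> * \<sigma> z ^ q ^ J] :: 'a ^ 6)" for x y z
    by (simp add: vec_eq_iff forall_6 hom field_automorphism_power[OF assms])
  show ?thesis
  proof (intro subset_antisym subsetI)
    fix w assume "w \<in> (\<lambda>u. \<chi> i. \<sigma> (u $ i)) ` U_set q I J \<alpha> \<beta> \<gamma>"
    then obtain x y z where "w = (\<chi> i. \<sigma> (vector [x, y, z, x ^ q ^ I + \<alpha> * y ^ q ^ J,
        x ^ q ^ J + \<beta> * z ^ q ^ I, y ^ q ^ I + \<gamma> * z ^ q ^ J] $ i))"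
      unfolding U_set_def by blast
    then show "w \<in> U_set q I J (\<sigma> \<alpha>) (\<sigma> \<beta>) (\<sigma> \<gamma>)"
      unfolding v U_set_def by blast
  next
    fix w assume "w \<in> U_set q I J (\<sigma> \<alpha>) (\<sigma> \<beta>) (\<sigma> \<gamma>)"
    then obtain x y z where w: "w = vector [x, y, z, x ^ q ^ I + \<sigma> \<alpha> * y ^ q ^ J,
        x ^ q ^ J + \<sigma> \<beta> * z ^ q ^ I, y ^ q ^ I + \<sigma> \<gamma> * z ^ q ^ J]"
      unfolding U_set_def by blast
    obtain x0 y0 z0 where "x = \<sigma> x0" "y = \<sigma> y0" "z = \<sigma> z0"
      using \<open>surj \<sigma>\<close> by (metis surjD)
    then have "w = (\<chi> i. \<sigma> (vector [x0, y0, z0, x0 ^ q ^ I + \<alpha> * y0 ^ q ^ J,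
        x0 ^ q ^ J + \<beta> * z0 ^ q ^ I, y0 ^ q ^ I + \<gamma> * z0 ^ q ^ J] $ i))"
      by (simp only: w v)
    then show "w \<in> (\<lambda>u. \<chi> i. \<sigma> (u $ i)) ` U_set q I J \<alpha> \<beta> \<gamma>"
      unfolding U_set_def by blast
  qed
qed

text \<open>Absorbing \<sigma> into the parameters leaves a purely linear question for each
  \<sigma>.\<close>

lemma GammaL_equivalent_U_set_iff:
  "GammaL_equivalent (U_set q I J \<alpha> \<beta> \<gamma>) U' \<longleftrightarrow>
    (\<exists>\<sigma>. field_automorphism \<sigma> \<and>
      (\<exists>M. invertible M \<and> U' = (*v) M ` U_set q I J (\<sigma> \<alpha>) (\<sigma> \<beta>) (\<sigma> \<gamma>)))"
proof -
  have "{M *v (\<chi> i. \<sigma> (u $ i)) | u. u \<in> U_set q I J \<alpha> \<beta> \<gamma>}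
      = (*v) M ` U_set q I J (\<sigma> \<alpha>) (\<sigma> \<beta>) (\<sigma> \<gamma>)"
    if "field_automorphism \<sigma>" for M :: "'a ^ 6 ^ 6" and \<sigma>
    unfolding field_automorphism_image_U_set[OF that, symmetric] image_image
    by (simp only: image_def Bex_def) blast
  then have "(field_automorphism \<sigma> \<and>
        (\<exists>M. invertible M \<and> U' = (*v) M ` U_set q I J (\<sigma> \<alpha>) (\<sigma> \<beta>) (\<sigma> \<gamma>))) \<longleftrightarrow>
      (\<exists>M. invertible M \<and> field_automorphism \<sigma> \<and>
        U' = {M *v (\<chi> i. \<sigma> (u $ i)) | u. u \<in> U_set q I J \<alpha> \<beta> \<gamma>})" for \<sigma>
    by (cases "field_automorphism \<sigma>") simp_all
  then show ?thesis unfolding GammaL_equivalent_def by blast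
qed

theorem theorem3p2:
  fixes q n I J K :: nat
    and \<alpha> \<beta> \<gamma> \<alpha>' \<beta>' \<gamma>' :: "'a::finite_field"
  assumes "primepow q"
    and "n > 0"
    and "CARD('a) = q ^ n"
    and "0 < I" and "I < J" and "real J < real n / 2"
    and "K = J - I"
    and "\<alpha> \<noteq> 0" and "\<beta> \<noteq> 0" and "\<gamma> \<noteq> 0"
    and "\<alpha>' \<noteq> 0" and "\<beta>' \<noteq> 0" and "\<gamma>' \<noteq> 0"
  shows "GammaL_equivalent (U_set q I J \<alpha> \<beta> \<gamma>) (U_set q I J \<alpha>' \<beta>' \<gamma>') \<longleftrightarrow>
    (\<exists>\<sigma>. field_automorphism \<sigma> \<and>
      (is_nth_power (q ^ (3 * K) - 1)
         ((\<alpha>' / \<sigma> \<alpha>) * (\<gamma>' / \<sigma> \<gamma>) ^ (q ^ K) * (\<sigma> \<beta> / \<beta>') ^ (q ^ (2 * K))) \<or>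
       is_nth_power (q ^ (3 * K) - 1)
         ((\<gamma>' / \<sigma> \<alpha>) * (1 / (\<sigma> \<gamma> * \<beta>')) ^ (q ^ K) * (\<alpha>' * \<sigma> \<beta>) ^ (q ^ (2 * K))) \<or>
       is_nth_power (q ^ (3 * K) - 1)
         ((1 / (\<sigma> \<alpha> * \<beta>')) * (\<alpha>' / \<sigma> \<gamma>) ^ (q ^ K) * (\<gamma>' * \<sigma> \<beta>) ^ (q ^ (2 * K)))))"
proof -
  obtain e where e: "e > 0" "q = CHAR('a) ^ e"
    using CHAR_power_of_card[OF assms(1-3)] .
  interpret frobenius_field q "TYPE('a)"
    by unfold_locales (use e in blast)
  have IJ: "J = I + K" "0 < K" "2 * J < n"
    using assms(5-7) by linarith+
  have "(\<exists>M. invertible M \<and> U_set q I J \<alpha>' \<beta>' \<gamma>' = (*v) M ` U_set q I J (\<sigma> \<alpha>) (\<sigma> \<beta>) (\<sigma> \<gamma>)) \<longleftrightarrow>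
      is_nth_power (q ^ (3 * K) - 1)
         ((\<alpha>' / \<sigma> \<alpha>) * (\<gamma>' / \<sigma> \<gamma>) ^ (q ^ K) * (\<sigma> \<beta> / \<beta>') ^ (q ^ (2 * K))) \<or>
      is_nth_power (q ^ (3 * K) - 1)
         ((\<gamma>' / \<sigma> \<alpha>) * (1 / (\<sigma> \<gamma> * \<beta>')) ^ (q ^ K) * (\<alpha>' * \<sigma> \<beta>) ^ (q ^ (2 * K))) \<or>
      is_nth_power (q ^ (3 * K) - 1)
         ((1 / (\<sigma> \<alpha> * \<beta>')) * (\<alpha>' / \<sigma> \<gamma>) ^ (q ^ K) * (\<gamma>' * \<sigma> \<beta>) ^ (q ^ (2 * K)))"
    if "field_automorphism \<sigma>" for \<sigma>
  proof -
    note nz = field_automorphism_nonzero[OF that assms(8)]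
      field_automorphism_nonzero[OF that assms(9)] field_automorphism_nonzero[OF that assms(10)]
    show ?thesis
      unfolding exists_invertible_image_U_set_iff[OF assms(3,4) IJ nz assms(11-13)]
      \<comment> \<open>The two sides list mutually inverse elements, in the same order.\<close>
      by (subst (1 2 3) is_nth_power_inverse_iff[symmetric])
        (simp only: Fr_def divide_inverse inverse_mult_distrib inverse_inverse_eq power_mult_distrib
          power_inverse mult_1_left mult_ac)
  qed
  then show ?thesis
    unfolding GammaL_equivalent_U_set_iff by blast
qed

end
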